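(* Let $X$ be an order complete locally solid $f$-ring with unity and the Fatou property. If $\mathsf{Hom}^{b}_{cr}(X)$ has the Lebesgue property, then $X$ has the Lebesgue property.
   Context: An $\ell$-ring (lattice ring) is a ring which is also a lattice, the additive group being a lattice-ordered group, with $|x\cdot y|\le |x|\cdot|y|$ for all $x,y$. $X_+=\{x\in X: x\ge 0\}$. A set $S\subseteq X$ is solid if $x\in X$, $y\in S$, $|x|\le|y|$ imply $x\in S$. A locally solid $\ell$-ring is an $\ell$-ring that is also a topological ring and has a local basis at zero consisting of solid sets. An $f$-ring is an $\ell$-ring in which $a\wedge b=0$ and $c>0$ imply $ca\wedge b=ac\wedge b=0$; a locally solid $f$-ring is a locally solid $\ell$-ring that is an $f$-ring. Order complete: every non-empty subset that is bounded above has a supremum. A net $(x_\alpha)$ is order convergent to $x$ if there is a net $(z_\beta)$ (possibly over a different index set) with $z_\beta\downarrow 0$ such that for every $\beta$ there is $\alpha_0$ with $|x_\alpha-x|\le z_\beta$ for all $\alpha\ge\alpha_0$. A set is order closed if it contains the limits of all order convergent nets lying in it. $X$ has the Fatou property if its topology has a local basis at zero consisting of solid order closed neighborhoods. A locally solid $\ell$-ring has the Lebesgue property if every net with $u_\alpha\downarrow 0$ converges to $0$ topologically. A group homomorphism $T:X\to X$ (of the additive group) is order bounded if it maps order bounded sets (sets contained in an order interval $[u,v]$) to order bounded sets. $\mathsf{Hom}^{b}_{cr}(X)$ is the set of all order bounded continuous group homomorphisms $X\to X$, with pointwise addition, composition as multiplication, the order $T\le S$ iff $T(x)\le S(x)$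 for all $x\in X_+$ (lattice operations given by Riesz–Kantorovich formulae, in particular $|T|(x)=\sup\{|T(u)|:|u|\le x\}$ for $x\in X_+$), and the topology of $cr$-convergence: $(S_\alpha)$ $cr$-converges to $S$ if for each zero neighborhood $W\subseteq X$ there is a zero neighborhood $U\subseteq X$ such that for every zero neighborhood $V\subseteq X$ there is $\alpha_0$ with $(S_\alpha-S)(U)\subseteq VW$ (set of products) for all $\alpha\ge\alpha_0$. It is a locally solid $\ell$-ring. Standing assumption: in every topological group considered (including the additive groups of topological rings), singletons are bounded in the group sense: for each $x$ and each neighborhood $U$ of the identity there is a positive integer $n$ with $x\in nU=\{x_1+\dots+x_n: x_i\in U\}$. *)

theory Defs
  imports Complex_Main "HOL-Library.Lattice_Algebras" "HOL-Library.Set_Algebras"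
begin

section \<open>Nets\<close>

text \<open>
  A net is a function \<open>u\<close> on a set \<open>I\<close> directed by a preorder \<open>le\<close>;
  \<open>le\<close> need not be antisymmetric.
\<close>

definition directed :: "'i set \<Rightarrow> ('i \<Rightarrow> 'i \<Rightarrow> bool) \<Rightarrow> bool" where
  "directed I le \<longleftrightarrow> I \<noteq> {} \<and> reflp_on I le \<and> transp_on I le \<and>
     (\<forall>i\<in>I. \<forall>j\<in>I. \<exists>k\<in>I. le i k \<and> le j k)"

definition net_filter :: "'i set \<Rightarrow> ('i \<Rightarrow> 'i \<Rightarrow> bool) \<Rightarrow> 'i filter" where
  "net_filter I le = (INF i\<in>I. principal {j\<in>I. le i j})"

lemma eventually_net_filter:
  assumes "directed I le"
  shows "eventually P (net_filter I le) \<longleftrightarrow> (\<exists>i\<in>I. \<forall>j\<in>I. le i j \<longrightarrow> P j)"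
proof -
  have "eventually P (net_filter I le) \<longleftrightarrow>
      (\<exists>i\<in>I. eventually P (principal {j\<in>I. le i j}))"
    unfolding net_filter_def
  proof (rule eventually_INF_base)
    show "I \<noteq> {}" using assms by (simp add: directed_def)
    fix a b assume ab: "a \<in> I" "b \<in> I"
    with assms obtain k where k: "k \<in> I" "le a k" "le b k"
      unfolding directed_def by blast
    have "{j\<in>I. le k j} \<subseteq> {j\<in>I. le a j} \<inter> {j\<in>I. le b j}"
      using assms ab k unfolding directed_def transp_on_def by blast
    with k show "\<exists>x\<in>I. principal {j\<in>I. le x j}
        \<le> inf (principal {j\<in>I. le a j}) (principal {j\<in>I. le b j})"
      by (auto intro!: bexI[of _ k])
  qed
  then show ?thesis by (auto simp: eventually_principal)
qed

text \<open>
  The net \<open>u\<close> in \<open>A\<close> decreases and has infimum \<open>l\<close> in \<open>A\<close>, with respect to the order \<open>r\<close> on \<open>A\<close>.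
\<close>

definition decreases_to ::
    "'b set \<Rightarrow> ('b \<Rightarrow> 'b \<Rightarrow> bool) \<Rightarrow> 'i set \<Rightarrow> ('i \<Rightarrow> 'i \<Rightarrow> bool) \<Rightarrow> ('i \<Rightarrow> 'b) \<Rightarrow> 'b \<Rightarrow> bool" where
  "decreases_to A r I le u l \<longleftrightarrow>
     (\<forall>i\<in>I. u i \<in> A) \<and> l \<in> A \<and>
     (\<forall>i\<in>I. \<forall>j\<in>I. le i j \<longrightarrow> r (u j) (u i)) \<and>
     (\<forall>i\<in>I. r l (u i)) \<and> (\<forall>b\<in>A. (\<forall>i\<in>I. r b (u i)) \<longrightarrow> r b l)"

lemma decreases_to_reindex:
  assumes "directed I le" "decreases_to A r I le u l" "reflp_on A r" "transp_on A r"
  shows "directed (u ` I) (\<lambda>x y. r y x)"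
    and "decreases_to A r (u ` I) (\<lambda>x y. r y x) (\<lambda>x. x) l"
proof -
  have sub: "u ` I \<subseteq> A" and dec: "\<And>i j. i \<in> I \<Longrightarrow> j \<in> I \<Longrightarrow> le i j \<Longrightarrow> r (u j) (u i)"
    using assms(2) by (auto simp: decreases_to_def)
  show "directed (u ` I) (\<lambda>x y. r y x)"
    unfolding directed_def
  proof (intro conjI ballI)
    show "u ` I \<noteq> {}" using assms(1) by (simp add: directed_def)
    show "reflp_on (u ` I) (\<lambda>x y. r y x)"
      using assms(3) sub by (auto simp: reflp_on_def)
    show "transp_on (u ` I) (\<lambda>x y. r y x)"
    proof (rule transp_onI)
      fix x y z assume "x \<in> u ` I" "y \<in> u ` I" "z \<in> u ` I" "r y x" "r z y"
      then show "r z x" using transp_onD[OF assms(4), of z y x] sub by blast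
    qed
    fix x y assume "x \<in> u ` I" "y \<in> u ` I"
    then obtain i j where ij: "i \<in> I" "j \<in> I" "x = u i" "y = u j" by blast
    then obtain k where "k \<in> I" "le i k" "le j k"
      using assms(1) unfolding directed_def by blast
    with ij dec show "\<exists>z\<in>u ` I. r z x \<and> r z y" by blast
  qed
  show "decreases_to A r (u ` I) (\<lambda>x y. r y x) (\<lambda>x. x) l"
    using assms(2) by (auto simp: decreases_to_def)
qed


section \<open>Locally solid lattice-ordered rings\<close>

definition zero_nhd :: "'a::{zero,topological_space} set \<Rightarrow> bool" where
  "zero_nhd U \<longleftrightarrow> eventually (\<lambda>x. x \<in> U) (nhds 0)"

definition solid :: "'a::lattice_ab_group_add_abs set \<Rightarrow> bool" where
  "solid S \<longleftrightarrow> (\<forall>x. \<forall>y\<in>S. \<bar>x\<bar> \<le> \<bar>y\<bar> \<longrightarrow> x \<in> S)"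

text \<open>
  Neither class assumes a unit, commutativity or the Hausdorff property. In \<open>lattice_ring\<close>
  the inequality \<open>\<bar>x * y\<bar> \<le> \<bar>x\<bar> * \<bar>y\<bar>\<close> is \<open>abs_le_mult\<close>; applied to \<open>x, y \<ge> 0\<close> it gives
  back the monotonicity of multiplication that the class assumes.
\<close>

class locally_solid_ring = lattice_ring + topological_group_add + topological_semigroup_mult +
  assumes solid_zero_basis:
    "eventually (\<lambda>x. x \<in> N) (nhds 0) \<Longrightarrow>
      \<exists>U\<subseteq>N. eventually (\<lambda>x. x \<in> U) (nhds 0) \<and> (\<forall>x. \<forall>y\<in>U. \<bar>x\<bar> \<le> \<bar>y\<bar> \<longrightarrow> x \<in> U)"

class f_ring = lattice_ring +
  assumes f_ring_left: "inf a b = 0 \<Longrightarrow> 0 < c \<Longrightarrow> inf (c * a) b = 0"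
    and f_ring_right: "inf a b = 0 \<Longrightarrow> 0 < c \<Longrightarrow> inf (a * c) b = 0"

definition singletons_bounded :: "'a::{ab_group_add,topological_space} itself \<Rightarrow> bool" where
  "singletons_bounded _ \<longleftrightarrow>
     (\<forall>(x::'a) U. zero_nhd U \<longrightarrow>
        (\<exists>n>0. \<exists>f :: nat \<Rightarrow> 'a. (\<forall>i<n. f i \<in> U) \<and> x = (\<Sum>i<n. f i)))"


section \<open>Order convergence, Fatou property and Lebesgue property\<close>

text \<open>
  The index set of the dominating net is taken inside \<open>'a\<close>; by \<open>decreases_to_reindex\<close> this is no
  restriction, see \<open>order_convergentI\<close>. Likewise for the nets in \<open>order_closed\<close>, see
  \<open>order_closedD\<close>.
\<close>

definition order_convergent ::
    "'i set \<Rightarrow> ('i \<Rightarrow> 'i \<Rightarrow> bool) \<Rightarrow> ('i \<Rightarrow> 'a::lattice_ab_group_add_abs) \<Rightarrow> 'a \<Rightarrow> bool" where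
  "order_convergent I le x l \<longleftrightarrow>
     (\<exists>(J :: 'a set) leJ z. directed J leJ \<and> decreases_to UNIV (\<le>) J leJ z 0 \<and>
        (\<forall>\<beta>\<in>J. \<exists>\<alpha>0\<in>I. \<forall>\<alpha>\<in>I. le \<alpha>0 \<alpha> \<longrightarrow> \<bar>x \<alpha> - l\<bar> \<le> z \<beta>))"

definition order_closed :: "'a::lattice_ab_group_add_abs set \<Rightarrow> bool" where
  "order_closed S \<longleftrightarrow>
     (\<forall>(I :: 'a set) le x l. directed I le \<longrightarrow> (\<forall>\<alpha>\<in>I. x \<alpha> \<in> S) \<longrightarrow>
        order_convergent I le x l \<longrightarrow> l \<in> S)"

lemma order_convergentI:
  fixes x :: "'i \<Rightarrow> 'a::lattice_ab_group_add_abs" and z :: "'j \<Rightarrow> 'a"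
  assumes "directed J leJ" "decreases_to UNIV (\<le>) J leJ z 0"
    and "\<And>\<beta>. \<beta> \<in> J \<Longrightarrow> \<exists>\<alpha>0\<in>I. \<forall>\<alpha>\<in>I. le \<alpha>0 \<alpha> \<longrightarrow> \<bar>x \<alpha> - l\<bar> \<le> z \<beta>"
  shows "order_convergent I le x l"
proof -
  have "reflp_on UNIV ((\<le>) :: 'a \<Rightarrow> 'a \<Rightarrow> bool)" "transp_on UNIV ((\<le>) :: 'a \<Rightarrow> 'a \<Rightarrow> bool)"
    by simp_all
  from decreases_to_reindex[OF assms(1,2) this] assms(3) show ?thesis
    unfolding order_convergent_def by (intro exI[of _ "z ` J"]) blast
qed

lemma order_closedD:
  fixes x :: "'i \<Rightarrow> 'a::lattice_ab_group_add_abs"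
  assumes "order_closed S" "directed I le" "\<And>\<alpha>. \<alpha> \<in> I \<Longrightarrow> x \<alpha> \<in> S" "order_convergent I le x l"
  shows "l \<in> S"
proof -
  obtain J :: "'a set" and leJ z where J: "directed J leJ" "decreases_to UNIV (\<le>) J leJ z 0"
    and bd: "\<forall>\<beta>\<in>J. \<exists>\<alpha>0\<in>I. \<forall>\<alpha>\<in>I. le \<alpha>0 \<alpha> \<longrightarrow> \<bar>x \<alpha> - l\<bar> \<le> z \<beta>"
    using assms(4) unfolding order_convergent_def by blast
  have "\<exists>\<alpha>\<in>I. \<bar>x \<alpha> - l\<bar> \<le> z \<beta>" if \<beta>: "\<beta> \<in> J" for \<beta>
  proof -
    from bd \<beta> obtain a where a: "a \<in> I" "\<forall>\<alpha>\<in>I. le a \<alpha> \<longrightarrow> \<bar>x \<alpha> - l\<bar> \<le> z \<beta>" by blast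
    moreover have "le a a" using a(1) assms(2) by (auto simp: directed_def reflp_on_def)
    ultimately show ?thesis by blast
  qed
  then obtain g where g: "\<And>\<beta>. \<beta> \<in> J \<Longrightarrow> g \<beta> \<in> I \<and> \<bar>x (g \<beta>) - l\<bar> \<le> z \<beta>" by metis
  have "order_convergent J leJ (\<lambda>\<beta>. x (g \<beta>)) l"
  proof (rule order_convergentI[OF J])
    fix \<beta> assume \<beta>: "\<beta> \<in> J"
    have "\<bar>x (g \<gamma>) - l\<bar> \<le> z \<beta>" if "\<gamma> \<in> J" "leJ \<beta> \<gamma>" for \<gamma>
    proof -
      have "z \<gamma> \<le> z \<beta>" using J(2) that \<beta> by (simp add: decreases_to_def)
      with g[OF that(1)] show ?thesis by (meson order_trans)
    qed
    with \<beta> show "\<exists>\<alpha>0\<in>J. \<forall>\<alpha>\<in>J. leJ \<alpha>0 \<alpha> \<longrightarrow> \<bar>x (g \<alpha>) - l\<bar> \<le> z \<beta>" by blast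
  qed
  moreover have "\<forall>\<beta>\<in>J. x (g \<beta>) \<in> S" using assms(3) g by blast
  ultimately show ?thesis using assms(1) J(1) unfolding order_closed_def by simp
qed

definition fatou_property :: "'a::locally_solid_ring itself \<Rightarrow> bool" where
  "fatou_property _ \<longleftrightarrow>
     (\<forall>N :: 'a set. zero_nhd N \<longrightarrow> (\<exists>U\<subseteq>N. zero_nhd U \<and> solid U \<and> order_closed U))"

definition lebesgue_property :: "'i itself \<Rightarrow> 'a::locally_solid_ring itself \<Rightarrow> bool" where
  "lebesgue_property _ _ \<longleftrightarrow>
     (\<forall>(I :: 'i set) le (u :: 'i \<Rightarrow> 'a). directed I le \<longrightarrow> decreases_to UNIV (\<le>) I le u 0 \<longrightarrow>
        (u \<longlongrightarrow> 0) (net_filter I le))"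


section \<open>Order bounded continuous group homomorphisms\<close>

definition order_bounded :: "'a::order set \<Rightarrow> bool" where
  "order_bounded B \<longleftrightarrow> (\<exists>u v. B \<subseteq> {u..v})"

definition hom_b :: "('a::locally_solid_ring \<Rightarrow> 'a) set" where
  "hom_b = {T. additive T \<and> continuous_on UNIV T \<and> (\<forall>B. order_bounded B \<longrightarrow> order_bounded (T ` B))}"

definition hom_le :: "('a::locally_solid_ring \<Rightarrow> 'a) \<Rightarrow> ('a \<Rightarrow> 'a) \<Rightarrow> bool" where
  "hom_le T S \<longleftrightarrow> (\<forall>x\<ge>0. T x \<le> S x)"

text \<open>\<open>V * W\<close> is the set of products \<open>v * w\<close>, not its additive span.\<close>

definition cr_convergent ::
    "'i set \<Rightarrow> ('i \<Rightarrow> 'i \<Rightarrow> bool) \<Rightarrow> ('i \<Rightarrow> 'a::locally_solid_ring \<Rightarrow> 'a) \<Rightarrow> ('a \<Rightarrow> 'a) \<Rightarrow> bool" where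
  "cr_convergent I le S T \<longleftrightarrow>
     (\<forall>W. zero_nhd W \<longrightarrow> (\<exists>U. zero_nhd U \<and> (\<forall>V. zero_nhd V \<longrightarrow>
        (\<exists>\<alpha>0\<in>I. \<forall>\<alpha>\<in>I. le \<alpha>0 \<alpha> \<longrightarrow> (\<lambda>x. S \<alpha> x - T x) ` U \<subseteq> V * W))))"

definition hom_b_cr_lebesgue :: "'i itself \<Rightarrow> 'a::locally_solid_ring itself \<Rightarrow> bool" where
  "hom_b_cr_lebesgue _ _ \<longleftrightarrow>
     (\<forall>(I :: 'i set) le (S :: 'i \<Rightarrow> 'a \<Rightarrow> 'a). directed I le \<longrightarrow>
        decreases_to hom_b hom_le I le S (\<lambda>_. 0) \<longrightarrow> cr_convergent I le S (\<lambda>_. 0))"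

text \<open>
  Index sets consisting of homomorphisms suffice, so the instance \<open>'i = 'a \<Rightarrow> 'a\<close> is the Lebesgue
  property for arbitrary nets.
\<close>

lemma hom_b_cr_lebesgue_any_index:
  assumes "hom_b_cr_lebesgue TYPE('a \<Rightarrow> 'a) TYPE('a::locally_solid_ring)"
  shows "hom_b_cr_lebesgue TYPE('i) TYPE('a)"
  unfolding hom_b_cr_lebesgue_def
proof (intro allI impI)
  fix I :: "'i set" and le and S :: "'i \<Rightarrow> 'a \<Rightarrow> 'a"
  assume dir: "directed I le" and dec: "decreases_to hom_b hom_le I le S (\<lambda>_. 0)"
  have refl: "reflp_on hom_b (hom_le :: ('a \<Rightarrow> 'a) \<Rightarrow> _)"
    by (rule reflp_onI) (simp add: hom_le_def)
  have trans: "transp_on hom_b (hom_le :: ('a \<Rightarrow> 'a) \<Rightarrow> _)"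
  proof (rule transp_onI)
    fix R S T :: "'a \<Rightarrow> 'a" assume RS: "hom_le R S" "hom_le S T"
    show "hom_le R T"
      unfolding hom_le_def
    proof (intro allI impI)
      fix x :: 'a assume "0 \<le> x"
      with RS have "R x \<le> S x" "S x \<le> T x" by (auto simp: hom_le_def)
      then show "R x \<le> T x" by (rule order_trans)
    qed
  qed
  note re = decreases_to_reindex[OF dir dec refl trans]
  have cr: "cr_convergent (S ` I) (\<lambda>x y. hom_le y x) (\<lambda>x. x) (\<lambda>_. 0)"
    using assms re unfolding hom_b_cr_lebesgue_def by simp
  have mono: "hom_le (S j) (S i)" if "i \<in> I" "j \<in> I" "le i j" for i j
    using dec that by (simp add: decreases_to_def)
  show "cr_convergent I le S (\<lambda>_. 0)"
    unfolding cr_convergent_def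
  proof (intro allI impI)
    fix W :: "'a set" assume W: "zero_nhd W"
    from cr[unfolded cr_convergent_def, rule_format, OF W] obtain U where U: "zero_nhd U" and
      V: "\<forall>V. zero_nhd V \<longrightarrow> (\<exists>T0\<in>S ` I. \<forall>T\<in>S ` I. hom_le T T0 \<longrightarrow> (\<lambda>x. T x - 0) ` U \<subseteq> V * W)"
      by (elim exE conjE) (rule that)
    have "\<exists>i\<in>I. \<forall>j\<in>I. le i j \<longrightarrow> (\<lambda>x. S j x - 0) ` U \<subseteq> V * W" if "zero_nhd V" for V
    proof -
      from V[rule_format, OF that] obtain i where i: "i \<in> I"
        and le: "\<forall>T\<in>S ` I. hom_le T (S i) \<longrightarrow> (\<lambda>x. T x - 0) ` U \<subseteq> V * W"
        by (elim bexE imageE) simp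
      show ?thesis
      proof (rule bexI[OF _ i], intro ballI impI)
        fix j assume "j \<in> I" "le i j"
        with mono[OF i] le show "(\<lambda>x. S j x - 0) ` U \<subseteq> V * W" by simp
      qed
    qed
    with U show "\<exists>U. zero_nhd U \<and> (\<forall>V. zero_nhd V \<longrightarrow>
        (\<exists>i\<in>I. \<forall>j\<in>I. le i j \<longrightarrow> (\<lambda>x. S j x - 0) ` U \<subseteq> V * W))"
      by (intro exI[of _ U]) simp
  qed
qed

end

theory Submission
  imports Defs
begin

text \<open>
  Let \<open>u\<close> be a net decreasing to \<open>0\<close>. The right multiplications \<open>y \<mapsto> y * u \<alpha>\<close> are order bounded
  continuous homomorphisms, and they decrease to \<open>0\<close> in their turn because multiplication in an
  Archimedean unital \<open>f\<close>-ring is order continuous (\<open>le_mult_decreasing_imp_nonpos\<close>). So they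
  \<open>cr\<close>-converge to \<open>0\<close>, and the task is to evaluate this convergence at the unit.

  Given a neighbourhood \<open>W\<close>, \<open>cr\<close>-convergence supplies a neighbourhood \<open>U\<close> such that, for every
  neighbourhood \<open>V\<close>, eventually \<open>U * u \<alpha> \<subseteq> V * W\<close>. The unit need not lie in \<open>U\<close>; it is only a sum
  of \<open>n\<close> elements of \<open>U\<close>, where \<open>n\<close> depends on \<open>U\<close>. Hence \<open>u \<alpha>\<close> is a sum of \<open>n\<close> elements of
  \<open>V * W\<close>, and no choice of \<open>W\<close> makes such sums small, since \<open>W\<close> comes before \<open>n\<close>.

  The remedy is to use \<open>cr\<close>-convergence twice, with the same \<open>W\<close> and \<open>U\<close>. The first use, with a
  \<open>V\<close> whose \<open>n\<close>-fold sums stay in \<open>U\<close>, gives an index \<open>\<alpha>\<close> and a bound \<open>u \<alpha> \<le> v * w\<close> where \<open>v \<in> U\<close>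
  and \<open>w\<close> is some element, possibly large. Now that \<open>w\<close> is fixed, continuity gives a neighbourhood
  \<open>V'\<close> with \<open>V' * w \<subseteq> W\<close>. The second use is for this \<open>V'\<close> and the element \<open>v\<close> of \<open>U\<close>: for all large
  \<open>\<beta>\<close> there are \<open>v' \<in> V'\<close> and \<open>w' \<in> W\<close> with \<open>v * u \<beta> = v' * w'\<close>, and still \<open>u \<beta> \<le> v * w\<close>. Think of
  functions: where \<open>v \<le> v'\<close> the latter gives \<open>u \<beta> \<le> v' * w\<close>, and where \<open>v > v'\<close> the former gives
  \<open>u \<beta> \<le> w'\<close>. So \<open>u \<beta> \<le> v' * w + w'\<close> (\<open>le_from_two_factorizations\<close>), an element of \<open>W + W\<close>.
\<close>


section \<open>Disjointness in lattice-ordered groups and f-rings\<close>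

lemma sup_zero_minus_sup_uminus_zero:
  fixes a :: "'a::lattice_ab_group_add"
  shows "sup a 0 - sup (- a) 0 = a"
proof -
  have "a + sup (- a) 0 = sup a 0" by (simp only: add_sup_distrib_left right_minus add_0_right sup_commute)
  then show ?thesis by (simp only: diff_eq_eq)
qed

lemma inf_pos_part_neg_part:
  fixes a :: "'a::lattice_ab_group_add"
  shows "inf (sup a 0) (sup (- a) 0) = 0"
proof -
  have "sup a 0 = a + sup (- a) 0"
    using sup_zero_minus_sup_uminus_zero[of a] by (simp only: diff_eq_eq)
  then have "inf (sup a 0) (sup (- a) 0) = inf a 0 + sup (- a) 0"
    by (simp only: add_inf_distrib_right add_0)
  moreover have "inf a 0 = - sup (- a) 0" by (simp only: neg_sup_eq_inf minus_minus minus_zero)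
  ultimately show ?thesis by (simp only: left_minus)
qed

lemma le_of_le_add_disjoint:
  fixes p :: "'a::lattice_ab_group_add"
  assumes "inf p b = 0" "p \<le> a + b" "0 \<le> a"
  shows "p \<le> a"
proof -
  have "p - a \<le> inf p b" using assms(2,3) by (simp add: algebra_simps)
  with assms(1) show ?thesis by simp
qed

lemma inf_eq_zero_mono:
  fixes a :: "'a::lattice_ab_group_add"
  assumes "inf a b = 0" "0 \<le> a'" "a' \<le> a" "0 \<le> b'" "b' \<le> b"
  shows "inf a' b' = 0"
proof (rule antisym)
  show "inf a' b' \<le> 0" using inf_mono[OF assms(3,5)] assms(1) by simp
qed (use assms in simp)

lemma f_ring_left_nonneg:
  fixes a :: "'a::f_ring"
  assumes "inf a b = 0" "0 \<le> c"
  shows "inf (c * a) b = 0"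
proof (cases "c = 0")
  case True
  have "0 \<le> b" using assms(1) by (metis inf_le2)
  with True show ?thesis by (simp add: inf_absorb1)
next
  case False
  with assms show ?thesis by (intro f_ring_left) (auto simp: less_le)
qed

lemma f_ring_right_nonneg:
  fixes a :: "'a::f_ring"
  assumes "inf a b = 0" "0 \<le> c"
  shows "inf (a * c) b = 0"
proof (cases "c = 0")
  case True
  have "0 \<le> b" using assms(1) by (metis inf_le2)
  with True show ?thesis by (simp add: inf_absorb1)
next
  case False
  with assms show ?thesis by (intro f_ring_right) (auto simp: less_le)
qed

lemma disjoint_mult_eq_zero:
  fixes a :: "'a::f_ring"
  assumes "inf a b = 0"
  shows "a * b = 0"
proof -
  have nonneg: "0 \<le> a" "0 \<le> b" using assms by (metis inf_le1, metis inf_le2)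
  have "inf b (a * b) = 0"
    using f_ring_right_nonneg[OF assms nonneg(2)] by (simp add: inf_commute)
  from f_ring_left_nonneg[OF this nonneg(1)] show ?thesis by simp
qed

text \<open>The positive and the negative part annihilate each other, so the cross terms vanish.\<close>

lemma f_ring_square_nonneg:
  fixes a :: "'a::f_ring"
  shows "0 \<le> a * a"
proof -
  define p q where "p = sup a 0" and "q = sup (- a) 0"
  have a: "a = p - q" unfolding p_def q_def by (rule sup_zero_minus_sup_uminus_zero[symmetric])
  have "inf p q = 0" unfolding p_def q_def by (rule inf_pos_part_neg_part)
  then have "p * q = 0" "q * p = 0" by (simp_all add: disjoint_mult_eq_zero inf_commute)
  then have "a * a = p * p + q * q" by (simp add: a algebra_simps)
  then show ?thesis by (simp add: p_def q_def)
qed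


section \<open>The Archimedean property\<close>

text \<open>
  If \<open>s\<close> is the supremum of all natural multiples of \<open>g\<close>, then \<open>s - g\<close> is also an upper bound of
  them. Multiples are written as constant sums, because \<open>of_nat\<close> requires \<open>0 \<noteq> 1\<close> and the rings below
  may be trivial.
\<close>

lemma archimedean_nonpos:
  fixes g :: "'a::{lattice_ab_group_add, conditionally_complete_lattice}"
  assumes bound: "\<And>k :: nat. (\<Sum>i<k. g) \<le> c"
  shows "g \<le> 0"
proof -
  define m where "m k = (\<Sum>i<k. g)" for k :: nat
  have le: "m k \<le> c" for k unfolding m_def by (rule bound)
  have bdd: "bdd_above (range m)" by (rule bdd_aboveI2[OF le])
  have "m k \<le> Sup (range m) - g" for k
  proof -
    have "m (Suc k) \<le> Sup (range m)" by (rule cSup_upper[OF rangeI bdd])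
    moreover have "m (Suc k) = m k + g" unfolding m_def by (rule sum.lessThan_Suc)
    ultimately show ?thesis by (simp only: le_diff_eq)
  qed
  then have "Sup (range m) \<le> Sup (range m) - g" by (intro cSUP_least) simp_all
  then show ?thesis by (simp only: le_diff_eq add_le_same_cancel1)
qed

text \<open>
  The excess \<open>s = sup (z - 1) 0\<close> is disjoint from \<open>z * sup (1 - z) 0 = z + z * s\<close>, where \<open>z * z = 0\<close>
  removes the quadratic term. But \<open>s\<close> lies below that element, because \<open>0 \<le> 1 * 1\<close> gives \<open>s \<le> z\<close>.
\<close>

lemma square_zero_imp_le_one:
  fixes z :: "'a::{f_ring, monoid_mult}"
  assumes "0 \<le> z" "z * z = 0"
  shows "z \<le> 1"
proof -
  define r s where "r = sup (1 - z) 0" and "s = sup (z - 1) 0"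
  have rs: "inf r s = 0" "1 - z = r - s" "0 \<le> s"
    using inf_pos_part_neg_part[of "1 - z"] sup_zero_minus_sup_uminus_zero[of "1 - z"]
    by (simp_all add: r_def s_def)
  have "z * r - z * s = z * (1 - z)" by (simp only: rs(2) right_diff_distrib)
  also have "\<dots> = z" using assms(2) by (simp add: right_diff_distrib)
  finally have zr: "z * r = z + z * s" by (simp only: diff_eq_eq)
  have *: "inf (z * r) s = 0" by (rule f_ring_left_nonneg[OF rs(1) assms(1)])
  have zs: "0 \<le> z * s" using assms(1) rs(3) by simp
  have "z \<le> z * r" using zs by (simp add: zr)
  moreover have "s \<le> z"
    using assms(1) f_ring_square_nonneg[of "1 :: 'a"] by (simp add: s_def algebra_simps)
  ultimately have "s \<le> inf (z * r) s" by simp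
  then have "s \<le> 0" by (simp only: *)
  then show ?thesis by (simp add: s_def)
qed

text \<open>
  All multiples of \<open>z\<close> have square zero as well, so they stay below the unit, and the Archimedean
  property applies.
\<close>

lemma f_ring_reduced:
  fixes z :: "'a::{f_ring, monoid_mult, conditionally_complete_lattice}"
  assumes "0 \<le> z" "z * z = 0"
  shows "z = 0"
proof -
  have "(\<Sum>i<k. z) \<le> 1" for k :: nat
  proof (rule square_zero_imp_le_one)
    show "0 \<le> (\<Sum>i<k. z)" using assms(1) by (simp add: sum_nonneg)
    show "(\<Sum>i<k. z) * (\<Sum>i<k. z) = 0"
      by (simp only: sum_product assms(2) sum.neutral_const)
  qed
  from archimedean_nonpos[OF this] assms(1) show ?thesis by simp
qed


section \<open>Order continuity of multiplication\<close>

lemma sum_copies_mult: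
  fixes a :: "'a::comm_monoid_add" and k l :: nat
  shows "(\<Sum>i<k. \<Sum>j<l. a) = (\<Sum>i<k * l. a)"
proof -
  have "(\<Sum>j=i * l..<i * l + l. a) = (\<Sum>j<l. a)" for i
    using sum.shift_bounds_nat_ivl[of "\<lambda>_. a" 0 "i * l" l]
    by (simp add: lessThan_atLeast0 add.commute)
  then show ?thesis by (simp flip: sum.nat_group)
qed

lemma sum_copies_nonpos_of_decreasing:
  fixes u :: "'i \<Rightarrow> 'a::lattice_ab_group_add_abs" and k :: nat
  assumes dir: "directed I le" and dec: "decreases_to UNIV (\<le>) I le u 0"
    and "\<And>\<alpha>. \<alpha> \<in> I \<Longrightarrow> h \<le> (\<Sum>i<k. u \<alpha>)"
  shows "h \<le> 0"
  using assms(3)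
proof (induction k arbitrary: h)
  case 0
  obtain \<alpha> where "\<alpha> \<in> I" using dir unfolding directed_def by blast
  from 0[OF this] show ?case by simp
next
  case (Suc k)
  have inf: "b \<le> 0" if "\<And>\<alpha>. \<alpha> \<in> I \<Longrightarrow> b \<le> u \<alpha>" for b
    using dec that by (auto simp: decreases_to_def)
  show ?case
  proof (rule inf)
    fix \<alpha> assume \<alpha>: "\<alpha> \<in> I"
    have "h - u \<alpha> \<le> 0"
    proof (rule Suc.IH)
      fix \<beta> assume \<beta>: "\<beta> \<in> I"
      with \<alpha> dir obtain \<gamma> where \<gamma>: "\<gamma> \<in> I" "le \<alpha> \<gamma>" "le \<beta> \<gamma>" unfolding directed_def by blast
      have "h \<le> (\<Sum>i<k. u \<gamma>) + u \<gamma>" using Suc.prems[OF \<gamma>(1)] by simp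
      also have "\<dots> \<le> (\<Sum>i<k. u \<beta>) + u \<alpha>"
        using dec \<alpha> \<beta> \<gamma> by (intro add_mono sum_mono) (auto simp: decreases_to_def)
      finally show "h - u \<alpha> \<le> (\<Sum>i<k. u \<beta>)" by (simp add: algebra_simps)
    qed
    then show "h \<le> u \<alpha>" by simp
  qed
qed

text \<open>
  The inequality \<open>k y \<le> k\<^sup>2 + y\<^sup>2\<close> trades a factor \<open>y\<close> for a multiple of the unit, at the price of a
  bounded error: from \<open>g \<le> y * u \<alpha>\<close> it follows that \<open>k g \<le> k\<^sup>2 u \<alpha> + y\<^sup>2 * b\<close> for all \<open>\<alpha>\<close> past the
  index of \<open>b\<close>. Passing to the infimum over \<open>\<alpha>\<close> leaves \<open>k g \<le> y\<^sup>2 * b\<close> for every \<open>k\<close>.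
\<close>

lemma le_mult_decreasing_imp_nonpos:
  fixes u :: "'i \<Rightarrow> 'a::{f_ring, monoid_mult, conditionally_complete_lattice}"
  assumes dir: "directed I le" and dec: "decreases_to UNIV (\<le>) I le u 0"
    and y: "0 \<le> y" and g: "\<And>\<alpha>. \<alpha> \<in> I \<Longrightarrow> g \<le> y * u \<alpha>"
  shows "g \<le> 0"
proof -
  obtain \<alpha>0 where \<alpha>0: "\<alpha>0 \<in> I" using dir unfolding directed_def by blast
  have nonneg: "0 \<le> u \<alpha>" if "\<alpha> \<in> I" for \<alpha> using dec that by (simp add: decreases_to_def)
  have "(\<Sum>i<k. g) \<le> y * y * u \<alpha>0" for k :: nat
  proof -
    define K where "K = (\<Sum>i<k. 1 :: 'a)"
    have Kl: "K * a = (\<Sum>i<k. a)" for a by (simp add: K_def sum_distrib_right)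
    have Kr: "a * K = (\<Sum>i<k. a)" for a by (simp add: K_def sum_distrib_left)
    have comm: "y * K = K * y" by (simp only: Kl Kr)
    have "0 \<le> (y - K) * (y - K)" by (rule f_ring_square_nonneg)
    also have "\<dots> = y * y + K * K - K * y - K * y" by (simp add: algebra_simps comm)
    also have "\<dots> \<le> y * y + K * K - K * y" using y by (simp add: Kl sum_nonneg)
    finally have key: "K * y \<le> K * K + y * y" by (simp add: algebra_simps)
    have "K * g - y * y * u \<alpha>0 \<le> 0"
    proof (rule sum_copies_nonpos_of_decreasing[OF dir dec])
      fix \<alpha> assume \<alpha>: "\<alpha> \<in> I"
      with \<alpha>0 dir obtain \<gamma> where \<gamma>: "\<gamma> \<in> I" "le \<alpha>0 \<gamma>" "le \<alpha> \<gamma>" unfolding directed_def by blast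
      have mono: "u \<gamma> \<le> u \<alpha>0" "u \<gamma> \<le> u \<alpha>" using dec \<alpha> \<alpha>0 \<gamma> by (auto simp: decreases_to_def)
      have "K * g \<le> K * (y * u \<gamma>)" unfolding Kl by (intro sum_mono g \<gamma>)
      also have "\<dots> = (K * y) * u \<gamma>" by (simp add: mult.assoc)
      also have "\<dots> \<le> (K * K + y * y) * u \<gamma>" by (intro mult_right_mono key nonneg \<gamma>)
      also have "\<dots> = K * K * u \<gamma> + y * y * u \<gamma>" by (simp add: algebra_simps)
      also have "K * K * u \<gamma> = (\<Sum>i<k * k. u \<gamma>)"
        by (subst mult.assoc) (simp only: Kl sum_copies_mult)
      also have "\<dots> + y * y * u \<gamma> \<le> (\<Sum>i<k * k. u \<alpha>) + y * y * u \<alpha>0"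
        by (intro add_mono sum_mono mult_left_mono mono f_ring_square_nonneg)
      finally show "K * g - y * y * u \<alpha>0 \<le> (\<Sum>i<k * k. u \<alpha>)" by (simp add: algebra_simps)
    qed
    then show ?thesis by (simp add: Kl)
  qed
  then show ?thesis by (rule archimedean_nonpos)
qed


section \<open>Combining two factorizations\<close>

text \<open>
  On functions: if \<open>v \<le> v'\<close> at a point then \<open>x \<le> v * w \<le> v' * w\<close> there, and if \<open>v > v'\<close> then
  \<open>v * x \<le> v' * w' \<le> v * w'\<close> gives \<open>x \<le> w'\<close>. The pointwise case distinction says that \<open>p\<close>, the
  positive part of \<open>x - w'\<close>, and \<open>q\<close>, the positive part of \<open>v - v'\<close>, are disjoint.
\<close>

lemma le_from_two_factorizations:
  fixes x :: "'a::{f_ring, monoid_mult, conditionally_complete_lattice}"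
  assumes nonneg: "0 \<le> x" "0 \<le> v" "0 \<le> v'" "0 \<le> w" "0 \<le> w'"
    and small: "v * x \<le> v' * w'" and large: "x \<le> v * w"
  shows "x \<le> v' * w + w'"
proof -
  define p p' where "p = sup (x - w') 0" and "p' = sup (- (x - w')) 0"
  define q r where "q = sup (v - v') 0" and "r = sup (- (v - v')) 0"
  have pp': "inf p p' = 0" "x - w' = p - p'" "0 \<le> p" "0 \<le> p'"
    unfolding p_def p'_def
    by (rule inf_pos_part_neg_part, rule sup_zero_minus_sup_uminus_zero[symmetric], simp_all)
  have qr: "inf q r = 0" "v - v' = q - r" "0 \<le> q" "0 \<le> r"
    unfolding q_def r_def
    by (rule inf_pos_part_neg_part, rule sup_zero_minus_sup_uminus_zero[symmetric], simp_all)
  define z where "z = inf p q"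
  have z: "0 \<le> z" "z \<le> p" "z \<le> q" using pp' qr by (simp_all add: z_def)
  have "q \<le> v" using nonneg(2,3) by (simp add: q_def)
  \<comment> \<open>The inequality \<open>v * (x - w') \<le> - (v - v') * w'\<close>, written without negative terms.\<close>
  have "v * (x - w') \<le> v' * w' - v * w'" using small by (simp add: right_diff_distrib)
  also have "\<dots> = - ((v - v') * w')" by (simp add: left_diff_distrib)
  finally have "v * (p - p') \<le> - ((q - r) * w')" by (simp only: pp'(2) qr(2))
  then have "v * p + q * w' \<le> v * p' + r * w'" by (simp add: algebra_simps)
  moreover have "z * z \<le> v * p"
    
    using order_trans[OF z(3) \<open>q \<le> v\<close>] z(2) nonneg(2) z(1) by (rule mult_mono)
  moreover have "0 \<le> q * w'" using qr(3) nonneg(5) by (rule mult_nonneg_nonneg)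
  ultimately have zz: "z * z \<le> v * p' + r * w'"
    using add_increasing2[of "q * w'" "z * z" "v * p"] by (blast intro: order_trans)
  \<comment> \<open>Both terms on the right are disjoint from \<open>z\<close>, hence so is \<open>z * z\<close>.\<close>
  have "inf p' z = 0" "inf r z = 0"
    using inf_eq_zero_mono[OF pp'(1) z(1,2) pp'(4) order_refl]
      inf_eq_zero_mono[OF qr(1) z(1,3) qr(4) order_refl]
    by (simp_all only: inf_commute)
  then have disj: "inf (v * p') z = 0" "inf (r * w') z = 0"
    using nonneg(2,5) by (blast intro: f_ring_left_nonneg f_ring_right_nonneg)+
  have "inf (z * z) z \<le> v * p'"
  proof (rule le_of_le_add_disjoint)
    show "inf (inf (z * z) z) (r * w') = 0"
      using inf_eq_zero_mono[OF disj(2), of "r * w'" "inf (z * z) z"] z(1) nonneg(5) qr(4)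
      by (simp add: inf_commute)
    show "inf (z * z) z \<le> v * p' + r * w'" using inf_le1 zz by (rule order_trans)
    show "0 \<le> v * p'" using nonneg(2) pp'(4) by (rule mult_nonneg_nonneg)
  qed
  then have "inf (z * z) z \<le> inf (v * p') z" by simp
  then have "inf (z * z) z \<le> 0" by (simp only: disj(1))
  then have "inf (z * z) z = 0" by (rule antisym) (simp add: z(1))
  then have "inf (z * z) (z * z) = 0"
    using f_ring_right_nonneg[of z "z * z" z] z(1) by (simp only: inf_commute)
  then have "z = 0" using f_ring_reduced[OF z(1)] by (simp only: inf_idem)
  then have pq: "inf p (q * w) = 0"
    using f_ring_right_nonneg[of q p w] nonneg(4) by (simp add: z_def inf_commute)
  have "v - v' \<le> q" by (simp add: q_def)
  then have vq: "v \<le> v' + q" by (simp add: algebra_simps)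
  have "p \<le> v' * w"
  proof (rule le_of_le_add_disjoint[OF pq])
    have "p \<le> x" using nonneg(1,5) by (simp add: p_def)
    also have "\<dots> \<le> v * w" by (rule large)
    also have "\<dots> \<le> (v' + q) * w" by (intro mult_right_mono vq nonneg)
    finally show "p \<le> v' * w + q * w" by (simp add: distrib_right)
    show "0 \<le> v' * w" using nonneg(3,4) by (rule mult_nonneg_nonneg)
  qed
  moreover have "x - w' \<le> p" by (simp add: p_def)
  ultimately have "x - w' \<le> v' * w" by (rule order_trans[rotated])
  then show ?thesis by (simp only: diff_le_eq)
qed


section \<open>Neighbourhoods of zero\<close>

lemma solid_zero_nhd:
  fixes N :: "'a::locally_solid_ring set"
  assumes "zero_nhd N"
  obtains U where "U \<subseteq> N" "zero_nhd U" "solid U"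
  using solid_zero_basis[of N] assms unfolding zero_nhd_def solid_def by blast

lemma solidD: "solid S \<Longrightarrow> y \<in> S \<Longrightarrow> \<bar>x\<bar> \<le> \<bar>y\<bar> \<Longrightarrow> x \<in> S"
  by (auto simp: solid_def)

lemma zero_nhd_add:
  fixes N :: "'a::topological_group_add set"
  assumes "zero_nhd N"
  obtains V where "zero_nhd V" "\<And>x y. x \<in> V \<Longrightarrow> y \<in> V \<Longrightarrow> x + y \<in> N"
proof -
  have "((\<lambda>p :: 'a \<times> 'a. fst p + snd p) \<longlongrightarrow> 0 + 0) (nhds 0 \<times>\<^sub>F nhds 0)"
    by (rule tendsto_add_Pair)
  then have "filterlim (\<lambda>p. fst p + snd p) (nhds 0) (nhds (0 :: 'a) \<times>\<^sub>F nhds 0)" by simp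
  from this[unfolded filterlim_iff, rule_format, OF assms[unfolded zero_nhd_def]]
  obtain P Q where PQ: "eventually P (nhds (0 :: 'a))" "eventually Q (nhds (0 :: 'a))"
    "\<And>x y. P x \<Longrightarrow> Q y \<Longrightarrow> x + y \<in> N"
    by (auto simp: eventually_prod_filter)
  show ?thesis
    by (rule that[of "{x. P x \<and> Q x}"]) (use PQ in \<open>auto simp: zero_nhd_def eventually_conj_iff\<close>)
qed

lemma zero_nhd_sum:
  fixes N :: "'a::{ab_group_add, topological_group_add} set" and n :: nat
  assumes "zero_nhd N"
  obtains V where "zero_nhd V" "\<And>f. (\<And>i. i < n \<Longrightarrow> f i \<in> V) \<Longrightarrow> (\<Sum>i<n. f i) \<in> N"
  using assms
proof (induction n arbitrary: N thesis)
  case 0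
  have "0 \<in> N" using 0(2) unfolding zero_nhd_def by (rule eventually_nhds_x_imp_x)
  with 0 show ?case by (metis lessThan_0 sum.empty)
next
  case (Suc n)
  obtain M where M: "zero_nhd M" "\<And>x y. x \<in> M \<Longrightarrow> y \<in> M \<Longrightarrow> x + y \<in> N"
    using zero_nhd_add[OF Suc.prems(2)] by blast
  obtain V where V: "zero_nhd V" "\<And>f. (\<And>i. i < n \<Longrightarrow> f i \<in> V) \<Longrightarrow> (\<Sum>i<n. f i) \<in> M"
    using Suc.IH[OF _ M(1)] by blast
  show ?case
  proof (rule Suc.prems(1))
    show "zero_nhd (V \<inter> M)" using V(1) M(1) by (simp add: zero_nhd_def eventually_conj_iff)
    show "(\<Sum>i<Suc n. f i) \<in> N" if "\<And>i. i < Suc n \<Longrightarrow> f i \<in> V \<inter> M" for f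
      using that by (auto intro!: M(2) V(2))
  qed
qed

lemma zero_nhd_mult_right:
  fixes N :: "'a::locally_solid_ring set"
  assumes "zero_nhd N"
  shows "zero_nhd {v. v * w \<in> N}"
proof -
  have "((\<lambda>v. v * w) \<longlongrightarrow> 0 * w) (nhds 0)"
    by (intro tendsto_mult tendsto_const filterlim_ident)
  then have "((\<lambda>v. v * w) \<longlongrightarrow> 0) (nhds 0)" by simp
  from this[unfolded filterlim_iff, rule_format, OF assms[unfolded zero_nhd_def]]
  show ?thesis by (simp add: zero_nhd_def)
qed


section \<open>Multiplication operators\<close>

lemma mult_right_in_hom_b:
  fixes a :: "'a::locally_solid_ring"
  assumes "0 \<le> a"
  shows "(\<lambda>y. y * a) \<in> hom_b"
  unfolding hom_b_def
proof (intro CollectI conjI allI impI)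
  show "additive (\<lambda>y. y * a)" by (rule additive.intro) (simp add: distrib_right)
  have "((\<lambda>y. y * a) \<longlongrightarrow> y * a) (at y)" for y :: 'a
    by (intro tendsto_mult tendsto_const tendsto_ident_at)
  then show "continuous_on UNIV (\<lambda>y. y * a)" by (simp add: continuous_on_def)
  fix B :: "'a set" assume "order_bounded B"
  then obtain c d where "B \<subseteq> {c..d}" by (auto simp: order_bounded_def)
  then have "(\<lambda>y. y * a) ` B \<subseteq> {c * a..d * a}" using assms by (fastforce intro: mult_right_mono)
  then show "order_bounded ((\<lambda>y. y * a) ` B)" by (auto simp: order_bounded_def)
qed

lemma mult_right_decreases_to:
  fixes u :: "'i \<Rightarrow> 'a::{locally_solid_ring, f_ring, monoid_mult, conditionally_complete_lattice}"
  assumes dir: "directed I le" and dec: "decreases_to UNIV (\<le>) I le u 0"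
  shows "decreases_to hom_b hom_le I le (\<lambda>\<alpha> y. y * u \<alpha>) (\<lambda>_. 0)"
proof -
  have nonneg: "0 \<le> u \<alpha>" if "\<alpha> \<in> I" for \<alpha> using dec that by (simp add: decreases_to_def)
  have mono: "u \<beta> \<le> u \<alpha>" if "\<alpha> \<in> I" "\<beta> \<in> I" "le \<alpha> \<beta>" for \<alpha> \<beta>
    using dec that by (simp add: decreases_to_def)
  have "hom_le b (\<lambda>_. 0)" if "\<forall>\<alpha>\<in>I. hom_le b (\<lambda>y. y * u \<alpha>)" for b
    unfolding hom_le_def
  proof (intro allI impI)
    fix y :: 'a assume y: "0 \<le> y"
    show "b y \<le> 0"
      by (rule le_mult_decreasing_imp_nonpos[OF dir dec y]) (use that y in \<open>auto simp: hom_le_def\<close>)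
  qed
  moreover have "(\<lambda>_. 0) \<in> (hom_b :: ('a \<Rightarrow> 'a) set)" using mult_right_in_hom_b[of 0] by simp
  ultimately show ?thesis
    using nonneg mono
    by (auto simp: decreases_to_def hom_le_def mult_right_in_hom_b intro: mult_left_mono)
qed


section \<open>Transfer of the Lebesgue property\<close>

theorem proposition8:
  assumes "singletons_bounded
      TYPE('a::{locally_solid_ring, f_ring, monoid_mult, conditionally_complete_lattice})"
    and "fatou_property TYPE('a)"
    and "hom_b_cr_lebesgue TYPE('a \<Rightarrow> 'a) TYPE('a)"
  shows "lebesgue_property TYPE('i) TYPE('a)"
  unfolding lebesgue_property_def
proof (intro allI impI)
  fix I :: "'i set" and le and u :: "'i \<Rightarrow> 'a"
  assume dir: "directed I le" and dec: "decreases_to UNIV (\<le>) I le u 0"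
  have nonneg: "0 \<le> u \<alpha>" if "\<alpha> \<in> I" for \<alpha> using dec that by (simp add: decreases_to_def)
  have mono: "u \<beta> \<le> u \<alpha>" if "\<alpha> \<in> I" "\<beta> \<in> I" "le \<alpha> \<beta>" for \<alpha> \<beta>
    using dec that by (simp add: decreases_to_def)
  have trans: "le \<alpha> \<gamma>" if "\<alpha> \<in> I" "\<beta> \<in> I" "\<gamma> \<in> I" "le \<alpha> \<beta>" "le \<beta> \<gamma>" for \<alpha> \<beta> \<gamma>
    using dir that unfolding directed_def by (meson transp_onD)
  have cr: "cr_convergent I le (\<lambda>\<alpha> y. y * u \<alpha>) (\<lambda>_. 0)"
    using hom_b_cr_lebesgue_any_index[OF assms(3), where 'i = 'i] dir
      mult_right_decreases_to[OF dir dec]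
    unfolding hom_b_cr_lebesgue_def by blast
  have "eventually (\<lambda>\<alpha>. u \<alpha> \<in> N) (net_filter I le)" if N: "zero_nhd N" for N
  proof -
    obtain N' where N': "N' \<subseteq> N" "zero_nhd N'" "solid N'" using solid_zero_nhd[OF N] .
    obtain M where M: "zero_nhd M" "\<And>x y. x \<in> M \<Longrightarrow> y \<in> M \<Longrightarrow> x + y \<in> N'"
      using zero_nhd_add[OF N'(2)] by blast
    obtain W where W: "W \<subseteq> M" "zero_nhd W" "solid W" using solid_zero_nhd[OF M(1)] .
    obtain U where U: "zero_nhd U" and
      cr_U: "\<And>V. zero_nhd V \<Longrightarrow>
        \<exists>\<alpha>0\<in>I. \<forall>\<alpha>\<in>I. le \<alpha>0 \<alpha> \<longrightarrow> (\<lambda>y. y * u \<alpha> - 0) ` U \<subseteq> V * W"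
      using cr[unfolded cr_convergent_def, rule_format, OF W(2)] by (elim exE conjE) simp
    have factor: "\<exists>\<alpha>0\<in>I. \<forall>\<alpha>\<in>I. le \<alpha>0 \<alpha> \<longrightarrow>
        (\<forall>y\<in>U. \<exists>v\<in>V. \<exists>w\<in>W. 0 \<le> v \<and> 0 \<le> w \<and> \<bar>y * u \<alpha>\<bar> \<le> v * w)"
      if V: "zero_nhd V" "solid V" for V
    proof -
      have "\<exists>v\<in>V. \<exists>w\<in>W. 0 \<le> v \<and> 0 \<le> w \<and> \<bar>a\<bar> \<le> v * w" if a: "a \<in> V * W" for a
      proof -
        from a obtain v w where vw: "v \<in> V" "w \<in> W" "a = v * w" by (auto elim: set_times_elim)
        then have "\<bar>v\<bar> \<in> V" "\<bar>w\<bar> \<in> W" using solidD[OF V(2)] solidD[OF W(3)] by auto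
        moreover have "\<bar>a\<bar> \<le> \<bar>v\<bar> * \<bar>w\<bar>" using vw(3) by (simp add: abs_le_mult)
        ultimately show ?thesis using abs_ge_zero by blast
      qed
      then have prod: "\<exists>v\<in>V. \<exists>w\<in>W. 0 \<le> v \<and> 0 \<le> w \<and> \<bar>y * u \<alpha>\<bar> \<le> v * w"
        if "(\<lambda>y. y * u \<alpha> - 0) ` U \<subseteq> V * W" "y \<in> U" for \<alpha> y
        using that by (simp add: image_subset_iff)
      obtain \<alpha>0 where "\<alpha>0 \<in> I"
        "\<forall>\<alpha>\<in>I. le \<alpha>0 \<alpha> \<longrightarrow> (\<lambda>y. y * u \<alpha> - 0) ` U \<subseteq> V * W"
        using cr_U[OF V(1)] by (elim bexE)
      then show ?thesis by (intro bexI[of _ \<alpha>0] ballI impI prod) simp_all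
    qed
    obtain n :: nat and f where f: "\<And>i. i < n \<Longrightarrow> f i \<in> U" "1 = (\<Sum>i<n. f i)"
      using assms(1)[unfolded singletons_bounded_def, rule_format, OF U, of 1] by blast

    \<comment> \<open>First use: a bound \<open>v * w\<close> with \<open>v \<in> U\<close>, but without control over \<open>w\<close>.\<close>
    obtain V0 where V0: "zero_nhd V0" "\<And>g. (\<And>i. i < n \<Longrightarrow> g i \<in> V0) \<Longrightarrow> (\<Sum>i<n. g i) \<in> U"
      using zero_nhd_sum[OF U] by blast
    obtain V where V: "V \<subseteq> V0" "zero_nhd V" "solid V" using solid_zero_nhd[OF V0(1)] .
    obtain \<alpha> where \<alpha>: "\<alpha> \<in> I"
      "\<forall>y\<in>U. \<exists>v\<in>V. \<exists>w\<in>W. 0 \<le> v \<and> 0 \<le> w \<and> \<bar>y * u \<alpha>\<bar> \<le> v * w"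
    proof -
      have refl: "le \<alpha> \<alpha>" if "\<alpha> \<in> I" for \<alpha>
        using dir that by (simp add: directed_def reflp_on_def)
      obtain \<alpha>0 where "\<alpha>0 \<in> I" and "\<forall>\<alpha>\<in>I. le \<alpha>0 \<alpha> \<longrightarrow>
          (\<forall>y\<in>U. \<exists>v\<in>V. \<exists>w\<in>W. 0 \<le> v \<and> 0 \<le> w \<and> \<bar>y * u \<alpha>\<bar> \<le> v * w)"
        using factor[OF V(2,3)] by (elim bexE)
      with refl that show ?thesis by simp
    qed
    have "\<exists>v w. v \<in> V \<and> 0 \<le> v \<and> 0 \<le> w \<and> \<bar>f i * u \<alpha>\<bar> \<le> v * w" if "i < n" for i
      using \<alpha>(2)[rule_format, OF f(1)[OF that]] by blast
    then obtain g h where gh: "\<And>i. i < n \<Longrightarrow> g i \<in> V"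
      "\<And>i. i < n \<Longrightarrow> 0 \<le> g i" "\<And>i. i < n \<Longrightarrow> 0 \<le> h i"
      "\<And>i. i < n \<Longrightarrow> \<bar>f i * u \<alpha>\<bar> \<le> g i * h i"
      by metis
    define v w where "v = (\<Sum>i<n. g i)" and "w = (\<Sum>i<n. h i)"
    have "v \<in> U" unfolding v_def by (rule V0(2)) (use gh(1) V(1) in blast)
    have vw: "0 \<le> v" "0 \<le> w" using gh by (auto simp: v_def w_def intro: sum_nonneg)
    have "u \<alpha> = (\<Sum>i<n. f i * u \<alpha>)" by (simp flip: sum_distrib_right f(2))
    also have "\<dots> \<le> (\<Sum>i<n. g i * w)"
    proof (intro sum_mono)
      fix i assume "i \<in> {..<n}"
      then have i: "i < n" by simp
      have "h i \<le> w" unfolding w_def by (rule sum_nonneg_leq_bound[OF _ _ refl]) (use gh(3) i in auto)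
      have "f i * u \<alpha> \<le> \<bar>f i * u \<alpha>\<bar>" by (rule abs_ge_self)
      also have "\<dots> \<le> g i * h i" by (rule gh(4)[OF i])
      also have "\<dots> \<le> g i * w" by (rule mult_left_mono[OF \<open>h i \<le> w\<close> gh(2)[OF i]])
      finally show "f i * u \<alpha> \<le> g i * w" .
    qed
    also have "\<dots> = v * w" by (simp add: v_def sum_distrib_right)
    finally have large: "u \<alpha> \<le> v * w" .

    \<comment> \<open>Second use: now \<open>w\<close> is fixed, and \<open>V'\<close> may depend on it.\<close>
    obtain V' where V': "V' \<subseteq> {a. a * w \<in> W}" "zero_nhd V'" "solid V'"
      using solid_zero_nhd[OF zero_nhd_mult_right[OF W(2)]] .
    obtain \<beta> where \<beta>: "\<beta> \<in> I" "\<And>\<delta>. \<delta> \<in> I \<Longrightarrow> le \<beta> \<delta> \<Longrightarrow>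
        \<exists>v'\<in>V'. \<exists>w'\<in>W. 0 \<le> v' \<and> 0 \<le> w' \<and> \<bar>v * u \<delta>\<bar> \<le> v' * w'"
    proof -
      obtain \<alpha>0 where "\<alpha>0 \<in> I" and \<alpha>0: "\<forall>\<alpha>\<in>I. le \<alpha>0 \<alpha> \<longrightarrow>
          (\<forall>y\<in>U. \<exists>v\<in>V'. \<exists>w\<in>W. 0 \<le> v \<and> 0 \<le> w \<and> \<bar>y * u \<alpha>\<bar> \<le> v * w)"
        using factor[OF V'(2,3)] by (elim bexE)
      show ?thesis
        by (rule that[OF \<open>\<alpha>0 \<in> I\<close>]) (rule \<alpha>0[rule_format, OF _ _ \<open>v \<in> U\<close>])
    qed
    obtain \<gamma> where \<gamma>: "\<gamma> \<in> I" "le \<alpha> \<gamma>" "le \<beta> \<gamma>"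
      using dir \<alpha>(1) \<beta>(1) unfolding directed_def by blast
    have "u \<delta> \<in> N" if \<delta>: "\<delta> \<in> I" "le \<gamma> \<delta>" for \<delta>
    proof -
      have "le \<alpha> \<delta>" "le \<beta> \<delta>" using trans \<alpha>(1) \<beta>(1) \<gamma> \<delta> by blast+
      then obtain v' w' where v'w': "v' \<in> V'" "w' \<in> W" "0 \<le> v'" "0 \<le> w'" "\<bar>v * u \<delta>\<bar> \<le> v' * w'"
        using \<beta>(2) \<delta>(1) by meson
      have bound: "u \<delta> \<le> v' * w + w'"
      proof (rule le_from_two_factorizations)
        show "v * u \<delta> \<le> v' * w'" using v'w'(5) abs_ge_self by (meson order_trans)
        show "u \<delta> \<le> v * w" using mono[OF \<alpha>(1) \<delta>(1) \<open>le \<alpha> \<delta>\<close>] large by (rule order_trans)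
      qed (use nonneg \<delta> vw v'w' in simp_all)
      have "v' * w + w' \<in> N'" using M(2) W(1) V'(1) v'w' by blast
      moreover have "\<bar>u \<delta>\<bar> \<le> \<bar>v' * w + w'\<bar>"
        using bound nonneg[OF \<delta>(1)] by (simp add: abs_of_nonneg order_trans[OF _ bound])
      ultimately show ?thesis using solidD[OF N'(3)] N'(1) by blast
    qed
    with \<gamma>(1) show ?thesis unfolding eventually_net_filter[OF dir] by blast
  qed
  then show "(u \<longlongrightarrow> 0) (net_filter I le)"
    by (intro topological_tendstoI) (simp add: zero_nhd_def eventually_nhds_in_open)
qed

end
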